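(* Let $f$ be a divergence with convex conjugate $g$, let $\varepsilon>0$, and let $X\in\mathcal{L}_{\bar g}$. Then $$\underline{R}_{f,\varepsilon}(X)=\sup_{\mu\in\mathbb{R}}\left\{\mu+W_{g_\varepsilon}(X-\mu)\right\}=\sup_{\mu\in\mathbb{R},\,t>0}\left\{\mu-t\left(1+\mathbb{E}_{\mathbb{P}}\left[g_\varepsilon\left(-\frac{X-\mu}{t}\right)\right]\right)\right\}.$$
   Context: All random variables are real-valued on a complete probability space $(\Omega,\mathcal{F},\mathbb{P})$; $\mathbb{E}_{\mathbb{Q}}$ denotes expectation under a probability measure $\mathbb{Q}$; (in)equalities between random variables are meant almost surely. A divergence is a proper, lower-semicontinuous, convex function $f:[0,+\infty)\to[0,+\infty)\cup\{+\infty\}$ such that $f(1)=0$, $f(x)<+\infty$ for every $x\ge 0$ (in particular $f(0)<+\infty$), and $f$ is twice continuously differentiable at every $x>0$. It is extended to $\mathbb{R}$ by $f(x)=+\infty$ for $x<0$. Its convex conjugate is $g(y)=\sup_{x\in\mathbb{R}}\{xy-f(x)\}$, $y\in\mathbb{R}$. For $\varepsilon>0$ set $f_\varepsilon=\varepsilon^{-1}f$, whose convex conjugate is $g_\varepsilon(y)=\varepsilon^{-1}g(\varepsilon y)$. Define $\bar g(y)=0$ for $y<0$ and $\bar g(y)=g(y)$ for $y\ge 0$, and $\mathcal{L}_{\bar g}=\{X\mid \mathbb{E}_{\mathbb{P}}[\bar g(|X|/\lambda)]<+\infty\text{ for some }\lambda>0\}$. The lower-bounding Orlicz regret is $W_{g_\varepsilon}(Y)=\sup_{t>0}\left\{-t\left(1+\mathbb{E}_{\mathbb{P}}\left[g_\varepsilon\left(\frac{-Y}{t}\right)\right]\right)\right\}$.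 The lower-bounding divergence risk measure is $$\underline{R}_{f,\varepsilon}(X)=\inf\left\{\mathbb{E}_{\mathbb{Q}}[X]\;\middle|\;\mathbb{Q}\in\mathfrak{Q},\ \mathbb{E}_{\mathbb{P}}\left[f\left(\frac{d\mathbb{Q}}{d\mathbb{P}}\right)\right]\le\varepsilon\right\},$$ where $\mathfrak{Q}$ is the set of probability measures on $(\Omega,\mathcal{F})$ absolutely continuous with respect to $\mathbb{P}$ and $\frac{d\mathbb{Q}}{d\mathbb{P}}$ is the Radon–Nikodým derivative. *)

theory Defs
  imports "HOL-Probability.Probability"
begin

definition proper_on :: "real set \<Rightarrow> (real \<Rightarrow> ereal) \<Rightarrow> bool" where
  "proper_on S f \<longleftrightarrow> (\<forall>x\<in>S. f x \<noteq> -\<infinity>) \<and> (\<exists>x\<in>S. f x \<noteq> \<infinity>)"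

definition lsc_on :: "real set \<Rightarrow> (real \<Rightarrow> ereal) \<Rightarrow> bool" where
  "lsc_on S f \<longleftrightarrow> (\<forall>x\<in>S. f x \<le> Liminf (at x within S) f)"

text \<open>The library's \<open>convex_on\<close> is for real-valued functions. The inequality below is meant
  for functions that are nowhere \<open>-\<infinity>\<close> on \<open>S\<close>.\<close>

definition ereal_convex_on :: "real set \<Rightarrow> (real \<Rightarrow> ereal) \<Rightarrow> bool" where
  "ereal_convex_on S f \<longleftrightarrow> convex S \<and>
    (\<forall>x\<in>S. \<forall>y\<in>S. \<forall>u\<ge>0. \<forall>v\<ge>0. u + v = 1 \<longrightarrow>
       f (u * x + v * y) \<le> ereal u * f x + ereal v * f y)"

definition C2_on_pos :: "(real \<Rightarrow> real) \<Rightarrow> bool" where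
  "C2_on_pos h \<longleftrightarrow> (\<exists>h' h''.
     (\<forall>x>0. (h has_real_derivative h' x) (at x)) \<and>
     (\<forall>x>0. (h' has_real_derivative h'' x) (at x)) \<and>
     continuous_on {0<..} h'')"

text \<open>The first conjunct is the convention that a divergence, a function on \<open>[0, \<infinity>)\<close>, is
  extended to the real line by \<open>\<infinity>\<close>.\<close>

definition is_divergence :: "(real \<Rightarrow> ereal) \<Rightarrow> bool" where
  "is_divergence f \<longleftrightarrow>
     (\<forall>x<0. f x = \<infinity>) \<and>
     (\<forall>x\<ge>0. 0 \<le> f x) \<and>
     proper_on {0..} f \<and> lsc_on {0..} f \<and> ereal_convex_on {0..} f \<and>
     f 1 = 0 \<and>
     (\<forall>x\<ge>0. f x < \<infinity>) \<and>
     C2_on_pos (\<lambda>x. real_of_ereal (f x))"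

definition convex_conjugate :: "(real \<Rightarrow> ereal) \<Rightarrow> real \<Rightarrow> ereal" where
  "convex_conjugate f y = (SUP x. ereal (x * y) - f x)"

definition scaled_conjugate :: "(real \<Rightarrow> ereal) \<Rightarrow> real \<Rightarrow> real \<Rightarrow> ereal" where
  "scaled_conjugate g \<epsilon> y = ereal (inverse \<epsilon>) * g (\<epsilon> * y)"

lemma scaled_conjugate_eq:
  assumes "\<epsilon> > 0"
  shows "scaled_conjugate (convex_conjugate f) \<epsilon> =
           convex_conjugate (\<lambda>x. ereal (inverse \<epsilon>) * f x)"
proof
  fix y
  have pos: "0 < inverse \<epsilon>" using assms by simp
  have "ereal (inverse \<epsilon>) * (ereal (x * (\<epsilon> * y)) - f x)
        = ereal (x * y) - ereal (inverse \<epsilon>) * f x" for x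
    using assms pos by (cases "f x") (simp_all add: field_simps)
  moreover have "ereal (inverse \<epsilon>) * (SUP x. ereal (x * (\<epsilon> * y)) - f x)
        = (SUP x. ereal (inverse \<epsilon>) * (ereal (x * (\<epsilon> * y)) - f x))"
    using pos by (subst Sup_ereal_mult_left') simp_all
  ultimately show "scaled_conjugate (convex_conjugate f) \<epsilon> y =
        convex_conjugate (\<lambda>x. ereal (inverse \<epsilon>) * f x) y"
    by (simp add: scaled_conjugate_def convex_conjugate_def)
qed

text \<open>Positive part minus negative part (\<open>e2ennreal\<close> sends negative numbers to \<open>0\<close>). Extended
  values are needed since the conjugate of a divergence may take the value \<open>\<infinity>\<close>, and since
  \<open>lebesgue_integral\<close> is \<open>0\<close> on non-integrable functions. The value is meaningful if
  one of the two parts is finite.\<close>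

definition expect :: "'a measure \<Rightarrow> ('a \<Rightarrow> ereal) \<Rightarrow> ereal" where
  "expect M Z = enn2ereal (\<integral>\<^sup>+ \<omega>. e2ennreal (Z \<omega>) \<partial>M) - enn2ereal (\<integral>\<^sup>+ \<omega>. e2ennreal (- Z \<omega>) \<partial>M)"

lemma expect_eq_integral:
  assumes "integrable M X"
  shows "expect M (\<lambda>\<omega>. ereal (X \<omega>)) = ereal (\<integral>\<omega>. X \<omega> \<partial>M)"
proof -
  have *: "e2ennreal (ereal x) = ennreal x" for x
    by (simp add: e2ennreal_ereal)
  have fin: "(\<integral>\<^sup>+ \<omega>. ennreal (X \<omega>) \<partial>M) \<noteq> \<infinity>" "(\<integral>\<^sup>+ \<omega>. ennreal (- X \<omega>) \<partial>M) \<noteq> \<infinity>"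
    using assms by (auto simp: real_integrable_def)
  have "enn2ereal a - enn2ereal b = ereal (enn2real a - enn2real b)"
    if "a \<noteq> \<infinity>" "b \<noteq> \<infinity>" for a b
    using that by (cases a; cases b) (auto simp: enn2ereal_ennreal)
  with fin show ?thesis
    by (simp add: expect_def * real_lebesgue_integral_def[OF assms])
qed

definition bar :: "(real \<Rightarrow> ereal) \<Rightarrow> real \<Rightarrow> ereal" where
  "bar g y = (if y < 0 then 0 else g y)"

definition Orlicz_space :: "'a measure \<Rightarrow> (real \<Rightarrow> ereal) \<Rightarrow> ('a \<Rightarrow> real) set" where
  "Orlicz_space P \<phi> = {X \<in> borel_measurable P. \<exists>l>0. expect P (\<lambda>\<omega>. \<phi> (\<bar>X \<omega>\<bar> / l)) < \<infinity>}"

definition lower_regret :: "'a measure \<Rightarrow> (real \<Rightarrow> ereal) \<Rightarrow> ('a \<Rightarrow> real) \<Rightarrow> ereal" where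
  "lower_regret P h Y = (SUP t\<in>{0<..}. - (ereal t * (1 + expect P (\<lambda>\<omega>. h (- Y \<omega> / t)))))"

definition ac_prob_measures :: "'a measure \<Rightarrow> 'a measure set" where
  "ac_prob_measures P = {Q. prob_space Q \<and> sets Q = sets P \<and> absolutely_continuous P Q}"

definition lower_risk :: "'a measure \<Rightarrow> (real \<Rightarrow> ereal) \<Rightarrow> real \<Rightarrow> ('a \<Rightarrow> real) \<Rightarrow> ereal" where
  "lower_risk P f \<epsilon> X =
     Inf {expect Q (\<lambda>\<omega>. ereal (X \<omega>)) | Q.
            Q \<in> ac_prob_measures P \<and>
            expect P (\<lambda>\<omega>. f (enn2real (RN_deriv P Q \<omega>))) \<le> ereal \<epsilon>}"

end

theory Submission
  imports Defs
begin

text \<open>Weak duality is the pointwise inequality \<open>x y \<le> f x + g y\<close>, integrated. For strong duality, the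
  risk is a convex minimisation over nonnegative densities \<open>Z\<close> with two scalar constraints,
  \<open>E[f Z] \<le> \<epsilon>\<close> and \<open>E[Z] = 1\<close>, so a separating hyperplane in three-dimensional space yields
  Lagrange multipliers \<open>t\<close> and \<open>- \<mu>\<close>; constant densities (\<open>1\<close>, where \<open>f\<close> vanishes, and \<open>0\<close>, \<open>2\<close>) exclude a
  degenerate hyperplane. The unconstrained Lagrangian is then optimised pointwise.\<close>

text \<open>With y = -(X - \<mu>)/t, the Lagrangian E[Z X] + t (E[f Z]/\<epsilon> - 1) - \<mu> (E[Z]
  - 1) equals \<mu> - t (1 + E[Z y - f(Z)/\<epsilon>]), so minimising it over Z turns the bracket
  into the conjugate and produces the dual objective. Two obstacles shape the proof. The integrals
  in the Lagrangian must be real numbers: membership of X in the Orlicz space secures this, through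
  Young's inequality, for every density of finite divergence. And a pointwise optimal Z need not be
  an admissible density, or even exist: the Lagrangian inequality is therefore tested only on
  densities with finite range, and monotone convergence reaches the supremum. The separation takes
  place among the values of objective and constraints, not among densities, so the risk may be an
  unattained infimum.\<close>

section \<open>Convex programs with one inequality and one equality constraint\<close>

text \<open>\<open>D\<close> carries no vector structure: \<open>comb\<close> asks only that the
  values, closed upwards in \<open>a\<close> and \<open>b\<close>, form a convex set.
  \<open>z0\<close> is a Slater point, and \<open>z1\<close>, \<open>z2\<close> put 0 strictly
  between two values of \<open>c\<close>.\<close>

lemma lagrange_multipliers:
  fixes a b c :: "'d \<Rightarrow> real"
  assumes comb: "\<And>z w u v. z \<in> D \<Longrightarrow> w \<in> D \<Longrightarrow> 0 \<le> u \<Longrightarrow> 0 \<le> v \<Longrightarrow> u + v = 1 \<Longrightarrow>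
      \<exists>x\<in>D. a x \<le> u * a z + v * a w \<and> b x \<le> u * b z + v * b w \<and> c x = u * c z + v * c w"
    and opt: "\<And>z. z \<in> D \<Longrightarrow> b z \<le> 0 \<Longrightarrow> c z = 0 \<Longrightarrow> p \<le> a z"
    and z0: "z0 \<in> D" "b z0 < 0" "c z0 = 0"
    and z1: "z1 \<in> D" "c z1 < 0"
    and z2: "z2 \<in> D" "c z2 > 0"
  shows "\<exists>t\<ge>0. \<exists>m. \<forall>z\<in>D. p \<le> a z + t * b z + m * c z"
proof -
  \<comment> \<open>The strict inequality in the first coordinate makes \<open>0 \<notin> S\<close>
    a restatement of \<open>opt\<close>. Upward closure in the first two coordinates later gives
    their multipliers the right sign.\<close>
  define S where "S = {(x, y, w). \<exists>z\<in>D. a z - p < x \<and> b z \<le> y \<and> c z = w}"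
  have "convex S"
    unfolding convex_def
  proof (intro ballI allI impI)
    fix s1 s2 and u v :: real
    assume s: "s1 \<in> S" "s2 \<in> S" and uv: "0 \<le> u" "0 \<le> v" "u + v = 1"
    obtain x1 y1 w1 x2 y2 w2 where s12: "s1 = (x1, y1, w1)" "s2 = (x2, y2, w2)"
      by (cases s1; cases s2) auto
    from s obtain z w where z: "z \<in> D" "a z - p < x1" "b z \<le> y1" "c z = w1"
      and w: "w \<in> D" "a w - p < x2" "b w \<le> y2" "c w = w2"
      unfolding S_def s12 by auto
    obtain x where x: "x \<in> D" "a x \<le> u * a z + v * a w" "b x \<le> u * b z + v * b w"
        "c x = u * c z + v * c w"
      using comb[OF z(1) w(1) uv] by auto
    have "u * (a z - p) + v * (a w - p) < u * x1 + v * x2"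
    proof (cases "u = 0")
      case True
      then show ?thesis using uv w by simp
    next
      case False
      then have "u * (a z - p) < u * x1" using uv z by simp
      moreover have "v * (a w - p) \<le> v * x2" using uv w by (intro mult_left_mono) auto
      ultimately show ?thesis by linarith
    qed
    moreover have "u * (a z - p) + v * (a w - p) = u * a z + v * a w - p"
    proof -
      have "p = (u + v) * p" using uv by simp
      then show ?thesis by (simp add: algebra_simps)
    qed
    ultimately have "a x - p < u * x1 + v * x2" using x by linarith
    moreover have "b x \<le> u * y1 + v * y2"
      using x(3) mult_left_mono[OF z(3) uv(1)] mult_left_mono[OF w(3) uv(2)] by linarith
    ultimately show "u *\<^sub>R s1 + v *\<^sub>R s2 \<in> S"
      using x z w unfolding S_def s12 by auto
  qed
  moreover have "0 \<notin> S"
    using opt unfolding S_def zero_prod_def by fastforce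
  ultimately obtain n where n: "n \<noteq> 0" "\<And>s. s \<in> S \<Longrightarrow> 0 \<le> n \<bullet> s"
    using separating_hyperplane_set_0[of S] by blast
  obtain \<alpha> \<tau> m where nn: "n = (\<alpha>, \<tau>, m)" by (cases n) auto
  have ineq: "0 \<le> \<alpha> * x + \<tau> * y + m * c z" if "z \<in> D" "a z - p < x" "b z \<le> y" for x y z
    using n(2)[of "(x, y, c z)"] that unfolding S_def nn by (auto simp: algebra_simps)
  \<comment> \<open>\<open>S\<close> contains rays in its first two directions, and a function r + s
    k that stays nonnegative along a ray has slope s at least 0. For s < 0 the witness gives it the
    value r - \<bar>r\<bar> - 1.\<close>
  have nonneg_slope: "0 \<le> s" if "\<And>k. 0 \<le> k \<Longrightarrow> 0 \<le> r + s * k" for r s :: real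
  proof (rule ccontr)
    assume "\<not> 0 \<le> s"
    then have "0 \<le> (\<bar>r\<bar> + 1) / (- s)" "r + s * ((\<bar>r\<bar> + 1) / (- s)) < 0"
      by (auto simp: divide_simps)
    then show False using that[of "(\<bar>r\<bar> + 1) / (- s)"] by linarith
  qed
  have \<alpha>: "0 \<le> \<alpha>"
  proof (rule nonneg_slope)
    fix k :: real assume "0 \<le> k"
    then show "0 \<le> \<alpha> * (a z0 - p + 1) + \<tau> * b z0 + m * c z0 + \<alpha> * k"
      using ineq[OF z0(1), of "a z0 - p + 1 + k" "b z0"] by (simp add: algebra_simps)
  qed
  have \<tau>: "0 \<le> \<tau>"
  proof (rule nonneg_slope)
    fix k :: real assume "0 \<le> k"
    then show "0 \<le> \<alpha> * (a z0 - p + 1) + \<tau> * b z0 + m * c z0 + \<tau> * k"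
      using ineq[OF z0(1), of "a z0 - p + 1" "b z0 + k"] by (simp add: algebra_simps)
  qed
  \<comment> \<open>If the normal had no objective component, \<open>z0\<close> would force \<tau> =
    0, and then the two signs of \<open>c\<close> at \<open>z1\<close> and \<open>z2\<close> would
    force m = 0, against \<open>n \<noteq> 0\<close>.\<close>
  have "\<alpha> \<noteq> 0"
  proof
    assume "\<alpha> = 0"
    with ineq have *: "0 \<le> \<tau> * b z + m * c z" if "z \<in> D" for z
      using that by (metis add_0 lt_ex gt_ex mult_zero_left order_refl)
    have "0 \<le> \<tau> * b z0" using *[OF z0(1)] z0 by simp
    then have "\<tau> = 0" using \<tau> z0(2) by (smt (verit) mult_pos_neg)
    with *[OF z1(1)] *[OF z2(1)] have "0 \<le> m * c z1" "0 \<le> m * c z2" by auto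
    then have "m = 0" using z1 z2 by (simp add: zero_le_mult_iff)
    then show False using n(1) \<open>\<alpha> = 0\<close> \<open>\<tau> = 0\<close> by (simp add: nn zero_prod_def)
  qed
  with \<alpha> have \<alpha>: "0 < \<alpha>" by simp
  have "p \<le> a z + (\<tau> / \<alpha>) * b z + (m / \<alpha>) * c z" if z: "z \<in> D" for z
  \<comment> \<open>The value a z - p itself is not covered by the strict inequality in
    \<open>S\<close>; it is approached from above by e > 0.\<close>
  proof (rule field_le_epsilon)
    fix e :: real assume "0 < e"
    then have "0 \<le> \<alpha> * (a z - p + e) + \<tau> * b z + m * c z"
      using ineq[OF z, of "a z - p + e" "b z"] by simp
    then have "0 \<le> (\<alpha> * (a z - p + e) + \<tau> * b z + m * c z) / \<alpha>" using \<alpha> by simp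
    also have "\<dots> = a z - p + e + (\<tau> / \<alpha>) * b z + (m / \<alpha>) * c z"
      using \<alpha> by (simp add: field_simps)
    finally show "p \<le> a z + (\<tau> / \<alpha>) * b z + (m / \<alpha>) * c z + e" by linarith
  qed
  moreover have "0 \<le> \<tau> / \<alpha>" using \<alpha> \<tau> by simp
  ultimately show ?thesis by blast
qed

section \<open>Extended-valued expectation\<close>

lemma expect_mono:
  assumes "\<And>\<omega>. \<omega> \<in> space M \<Longrightarrow> V \<omega> \<le> W \<omega>"
  shows "expect M V \<le> expect M W"
  unfolding expect_def
  by (intro ereal_minus_mono nn_integral_mono e2ennreal_mono)
     (auto simp: less_eq_ennreal.rep_eq[symmetric] assms intro!: nn_integral_mono e2ennreal_mono)

lemma expect_cong_AE:
  assumes "AE \<omega> in M. V \<omega> = W \<omega>"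
  shows "expect M V = expect M W"
proof -
  have "(\<integral>\<^sup>+ \<omega>. e2ennreal (V \<omega>) \<partial>M) = (\<integral>\<^sup>+ \<omega>. e2ennreal (W \<omega>) \<partial>M)"
       "(\<integral>\<^sup>+ \<omega>. e2ennreal (- V \<omega>) \<partial>M) = (\<integral>\<^sup>+ \<omega>. e2ennreal (- W \<omega>) \<partial>M)"
    using assms by (auto intro!: nn_integral_cong_AE)
  then show ?thesis by (simp add: expect_def)
qed

text \<open>In \<open>ereal\<close>, \<infinity> minus anything is \<infinity>, even \<infinity> -
  \<infinity>, so a value below \<infinity> forces the positive part to be finite.\<close>

lemma expect_less_top:
  assumes "expect M W < \<infinity>"
  shows "(\<integral>\<^sup>+ \<omega>. e2ennreal (W \<omega>) \<partial>M) < \<infinity>"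
  using assms unfolding expect_def
  by (cases "\<integral>\<^sup>+ \<omega>. e2ennreal (W \<omega>) \<partial>M") auto

text \<open>Reduces the expectation of a function bounded below to one nonnegative integral, where
  monotone convergence applies. The identity W^+ + c = (W + c) + W^- has only nonnegative terms, so
  it can be integrated at once, and W^- is at most c, so its integral can be subtracted.\<close>

lemma expect_eq_shift:
  assumes "prob_space M" and W[measurable]: "W \<in> borel_measurable M"
    and c: "0 \<le> c" and lb: "\<And>\<omega>. \<omega> \<in> space M \<Longrightarrow> - ereal c \<le> W \<omega>"
  shows "expect M W = enn2ereal (\<integral>\<^sup>+ \<omega>. e2ennreal (W \<omega> + ereal c) \<partial>M) - ereal c"
proof -
  interpret prob_space M by fact
  define p n s where "p = (\<integral>\<^sup>+ \<omega>. e2ennreal (W \<omega>) \<partial>M)" and "n = (\<integral>\<^sup>+ \<omega>. e2ennreal (- W \<omega>) \<partial>M)"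
    and "s = (\<integral>\<^sup>+ \<omega>. e2ennreal (W \<omega> + ereal c) \<partial>M)"
  have pt: "e2ennreal (W \<omega>) + ennreal c = e2ennreal (W \<omega> + ereal c) + e2ennreal (- W \<omega>)"
    if "\<omega> \<in> space M" for \<omega>
  proof (cases "W \<omega>")
    case (real r)
    then have "- c \<le> r" using lb[OF that] by simp
    then show ?thesis using c real
      by (cases "0 \<le> r") (simp_all add: e2ennreal_ereal ennreal_neg flip: ennreal_plus)
  qed (use lb[OF that] in auto)
  have nle: "e2ennreal (- W \<omega>) \<le> ennreal c" if "\<omega> \<in> space M" for \<omega>
    using lb[OF that] by (metis e2ennreal_ereal e2ennreal_mono ereal_uminus_le_reorder)
  have "p + ennreal c = (\<integral>\<^sup>+ \<omega>. e2ennreal (W \<omega>) + ennreal c \<partial>M)"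
    unfolding p_def by (subst nn_integral_add) (auto simp: emeasure_space_1)
  also have "\<dots> = (\<integral>\<^sup>+ \<omega>. e2ennreal (W \<omega> + ereal c) + e2ennreal (- W \<omega>) \<partial>M)"
    by (intro nn_integral_cong pt)
  also have "\<dots> = s + n"
    unfolding s_def n_def by (subst nn_integral_add) auto
  finally have eq: "p + ennreal c = s + n" .
  have "n \<le> (\<integral>\<^sup>+ \<omega>. ennreal c \<partial>M)"
    unfolding n_def by (intro nn_integral_mono nle)
  then have "n \<noteq> \<infinity>" by (auto simp: emeasure_space_1 top_unique)
  with eq c have "enn2ereal p - enn2ereal n = enn2ereal s - ereal c"
    by (cases p; cases n; cases s) (auto simp: enn2ereal_ennreal simp flip: ennreal_plus)
  then show ?thesis by (simp add: expect_def p_def n_def s_def)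
qed

section \<open>Interchange of supremum and expectation\<close>

lemma (in finite_measure) integrable_finite_range:
  fixes h :: "'a \<Rightarrow> real"
  assumes "h \<in> borel_measurable M" and fin: "finite (h ` space M)"
  shows "integrable M h"
proof (rule integrable_const_bound[where B = "Max (insert 0 ((\<lambda>x. \<bar>x\<bar>) ` h ` space M))"])
  show "AE x in M. norm (h x) \<le> Max (insert 0 ((\<lambda>x. \<bar>x\<bar>) ` h ` space M))"
    using fin by (intro AE_I2 Max_ge) auto
qed fact

lemma integrable_mult_finite_range:
  fixes h Y :: "'a \<Rightarrow> real"
  assumes "h \<in> borel_measurable M" and fin: "finite (h ` space M)" and Y: "integrable M Y"
  shows "integrable M (\<lambda>\<omega>. h \<omega> * Y \<omega>)"
proof -
  define B where "B = Max (insert 0 ((\<lambda>x. \<bar>x\<bar>) ` h ` space M))"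
  have "\<bar>h \<omega>\<bar> \<le> B" if "\<omega> \<in> space M" for \<omega>
    unfolding B_def using fin that by (intro Max_ge) auto
  then have "norm (h \<omega> * Y \<omega>) \<le> norm (B * \<bar>Y \<omega>\<bar>)" if "\<omega> \<in> space M" for \<omega>
    unfolding real_norm_def abs_mult abs_idempotent using that
    by (intro mult_right_mono order_trans[OF _ abs_ge_self] abs_ge_zero)
  then have "AE \<omega> in M. norm (h \<omega> * Y \<omega>) \<le> norm (B * \<bar>Y \<omega>\<bar>)" by (rule AE_I2)
  moreover have "(\<lambda>\<omega>. h \<omega> * Y \<omega>) \<in> borel_measurable M"
    using assms(1) borel_measurable_integrable[OF Y] by (rule borel_measurable_times)
  moreover have "integrable M (\<lambda>\<omega>. B * \<bar>Y \<omega>\<bar>)" using Y by simp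
  ultimately show ?thesis by (metis Bochner_Integration.integrable_bound)
qed

text \<open>Positive points are approximated by rationals to their right. Continuity is assumed only
  on the open half-line, but the endpoint 0 is itself among the values of \<open>q\<close>.\<close>

lemma SUP_nonneg_eq_SUP_rat:
  fixes \<phi> :: "real \<Rightarrow> real" and q :: "nat \<Rightarrow> real"
  assumes cont: "continuous_on {0<..} \<phi>" and q: "range q = \<rat> \<inter> {0..}"
  shows "(SUP x\<in>{0..}. ereal (\<phi> x)) = (SUP n. ereal (\<phi> (q n)))"
proof (rule antisym)
  have "q n \<in> {0..}" for n using q rangeI[of q n] by simp
  then show "(SUP n. ereal (\<phi> (q n))) \<le> (SUP x\<in>{0..}. ereal (\<phi> x))"
    by (intro SUP_least SUP_upper)
  show "(SUP x\<in>{0..}. ereal (\<phi> x)) \<le> (SUP n. ereal (\<phi> (q n)))"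
  proof (rule SUP_least)
    fix x :: real assume "x \<in> {0..}"
    then consider "x = 0" | "0 < x" unfolding atLeast_iff by linarith
    then show "ereal (\<phi> x) \<le> (SUP n. ereal (\<phi> (q n)))"
    proof cases
      case 1
      then have "x \<in> range q" using q by simp
      then obtain n where "x = q n" by (rule rangeE)
      then show ?thesis using SUP_upper[of n UNIV "\<lambda>n. ereal (\<phi> (q n))"] by simp
    next
      case 2
      show ?thesis
      proof (rule ccontr)
        assume "\<not> ?thesis"
        then have "(SUP n. ereal (\<phi> (q n))) < ereal (\<phi> x)" by simp
        from ereal_dense2[OF this] obtain e
          where e: "(SUP n. ereal (\<phi> (q n))) < ereal e" "ereal e < ereal (\<phi> x)"
          by blast
        have "open ({0<..} \<inter> \<phi> -` {e<..})"
          by (intro continuous_open_preimage cont) auto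
        moreover have "x \<in> {0<..} \<inter> \<phi> -` {e<..}" using 2 e by simp
        ultimately obtain d where d: "0 < d" "ball x d \<subseteq> {0<..} \<inter> \<phi> -` {e<..}"
          by (rule openE)
        obtain r where r: "r \<in> \<rat>" "x < r" "r < x + d"
          using Rats_dense_in_real[of x "x + d"] d(1) by (metis less_add_same_cancel1)
        then have "r \<in> ball x d" by (simp add: dist_real_def)
        with d(2) have "e < \<phi> r" by (metis IntD2 greaterThan_iff subsetD vimageD)
        moreover have "r \<in> range q" using q r 2 by simp
        then obtain n where "r = q n" by (rule rangeE)
        ultimately have "ereal e < ereal (\<phi> (q n))" by simp
        also have "\<dots> \<le> (SUP n. ereal (\<phi> (q n)))" by (rule SUP_upper) simp
        finally show False using e by simp
      qed
    qed
  qed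
qed

text \<open>Returns the maximising point, not the maximum, since with a \<phi> depending on the
  outcome this point serves as a density. One comparison per step makes its measurability an easy
  induction.\<close>

primrec running_argmax :: "(real \<Rightarrow> real) \<Rightarrow> (nat \<Rightarrow> real) \<Rightarrow> nat \<Rightarrow> real" where
  "running_argmax \<phi> q 0 = q 0"
| "running_argmax \<phi> q (Suc n) =
     (if \<phi> (running_argmax \<phi> q n) < \<phi> (q (Suc n)) then q (Suc n) else running_argmax \<phi> q n)"

lemma running_argmax_in: "running_argmax \<phi> q n \<in> q ` {..n}"
  by (induction n) (auto simp: atMost_Suc)

lemma incseq_running_argmax: "incseq (\<lambda>n. \<phi> (running_argmax \<phi> q n))"
  by (rule incseq_SucI) auto

lemma running_argmax_ge: "\<phi> (q n) \<le> \<phi> (running_argmax \<phi> q n)"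
  by (cases n) auto

lemma SUP_running_argmax:
  "(SUP n. ereal (\<phi> (running_argmax \<phi> q n))) = (SUP n. ereal (\<phi> (q n)))"
proof (rule antisym)
  show "(SUP n. ereal (\<phi> (running_argmax \<phi> q n))) \<le> (SUP n. ereal (\<phi> (q n)))"
  proof (rule SUP_least)
    fix n
    obtain k where "running_argmax \<phi> q n = q k" using running_argmax_in[of \<phi> q n] by auto
    then show "ereal (\<phi> (running_argmax \<phi> q n)) \<le> (SUP n. ereal (\<phi> (q n)))"
      by (auto intro: SUP_upper)
  qed
  show "(SUP n. ereal (\<phi> (q n))) \<le> (SUP n. ereal (\<phi> (running_argmax \<phi> q n)))"
  proof (rule SUP_mono)
    show "\<exists>k\<in>UNIV. ereal (\<phi> (q n)) \<le> ereal (\<phi> (running_argmax \<phi> q k))" for n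
      using running_argmax_ge[of \<phi> q n] by (intro bexI[of _ n]) simp_all
  qed
qed

text \<open>Interchange of supremum and expectation: along an enumeration of the nonnegative rationals,
  the running maximisers are measurable selections with finite range.\<close>

lemma expect_SUP_le:
  fixes H :: "real \<Rightarrow> real" and Y :: "'a \<Rightarrow> real"
  assumes "prob_space M" and Y: "integrable M Y"
    and H[measurable]: "H \<in> borel_measurable borel" and cont: "continuous_on {0<..} H"
    and le: "\<And>Z. Z \<in> borel_measurable M \<Longrightarrow> (\<And>\<omega>. 0 \<le> Z \<omega>) \<Longrightarrow> finite (range Z) \<Longrightarrow>
      (\<integral>\<omega>. Z \<omega> * Y \<omega> - H (Z \<omega>) \<partial>M) \<le> C"
  shows "expect M (\<lambda>\<omega>. SUP x\<in>{0..}. ereal (x * Y \<omega> - H x)) \<le> ereal C"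
proof -
  interpret prob_space M by fact
  have Y_meas[measurable]: "Y \<in> borel_measurable M" using Y by auto
  define c where "c = \<bar>H 0\<bar>"
  \<comment> \<open>The enumeration starts at 0 because x Y - H x equals - H 0 there, whatever the
    outcome. The running maxima thus have the uniform lower bound -c.\<close>
  obtain q :: "nat \<Rightarrow> real" where q: "range q = \<rat> \<inter> {0..}" "q 0 = 0"
  proof -
    define A :: "real set" where "A = \<rat> \<inter> {0..}"
    have "countable A" "A \<noteq> {}" "0 \<in> A"
      unfolding A_def using countable_rat by (auto intro: countable_subset)
    then have r: "range (from_nat_into A) = A" by (simp add: range_from_nat_into)
    show thesis
    proof
      have "range (case_nat 0 (from_nat_into A)) = insert 0 (range (from_nat_into A))"
        by (auto simp: image_iff split: nat.split) (metis old.nat.simps(5))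
      then show "range (case_nat 0 (from_nat_into A)) = \<rat> \<inter> {0..}"
        using r \<open>0 \<in> A\<close> unfolding A_def[symmetric] by auto
    qed simp
  qed
  have q_nonneg: "0 \<le> q n" for n using q by blast
  define Z where "Z n \<omega> = running_argmax (\<lambda>x. x * Y \<omega> - H x) q n" for n \<omega>
  define h where "h n \<omega> = Z n \<omega> * Y \<omega> - H (Z n \<omega>)" for n \<omega>
  have Z_in: "Z n \<omega> \<in> q ` {..n}" for n \<omega>
    unfolding Z_def by (rule running_argmax_in)
  have Z_nonneg: "0 \<le> Z n \<omega>" for n \<omega> using Z_in[of n \<omega>] q_nonneg by auto
  have Z_fin: "finite (range (Z n))" for n
    by (rule finite_subset[of _ "q ` {..n}"]) (use Z_in in auto)
  have Z_meas[measurable]: "Z n \<in> borel_measurable M" for n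
    unfolding Z_def by (induction n) simp_all
  have h_int: "integrable M (h n)" for n
  proof -
    have "integrable M (\<lambda>\<omega>. Z n \<omega> * Y \<omega>)"
      using Z_fin[of n] Y
      by (intro integrable_mult_finite_range) (auto intro: finite_subset[of _ "range (Z n)"])
    moreover have "integrable M (\<lambda>\<omega>. H (Z n \<omega>))"
      using Z_fin[of n]
      by (intro integrable_finite_range) (auto intro: finite_subset[of _ "H ` range (Z n)"])
    ultimately show ?thesis unfolding h_def by simp
  qed
  then have h_meas[measurable]: "h n \<in> borel_measurable M" for n by auto
  have h_mono: "incseq (\<lambda>n. h n \<omega>)" for \<omega>
    unfolding h_def Z_def
    by (rule incseq_running_argmax[of "\<lambda>x. x * Y \<omega> - H x"])
  have h_lb: "0 \<le> h n \<omega> + c" for n \<omega>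
    using incseqD[OF h_mono, of 0 n \<omega>] by (simp add: h_def Z_def q c_def)
  have SUP_h: "(SUP x\<in>{0..}. ereal (x * Y \<omega> - H x)) = (SUP n. ereal (h n \<omega>))" for \<omega>
    unfolding h_def Z_def
    by (subst SUP_nonneg_eq_SUP_rat[OF _ q(1)])
       (auto intro!: continuous_intros cont SUP_running_argmax[of "\<lambda>x. x * Y \<omega> - H x", symmetric])
  have lb: "- ereal c \<le> (SUP n. ereal (h n \<omega>))" for \<omega>
    using h_lb[of 0 \<omega>] by (intro SUP_upper2[of 0]) auto
  \<comment> \<open>The sign of C + c matters because \<open>ennreal\<close> truncates negative
    numbers to 0.\<close>
  have C: "0 \<le> C + c" "(\<integral>\<omega>. h n \<omega> + c \<partial>M) \<le> C + c" for n
  proof -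
    have *: "(\<integral>\<omega>. h n \<omega> + c \<partial>M) \<le> C + c" for n
    proof -
      have "(\<integral>\<omega>. h n \<omega> \<partial>M) \<le> C"
        unfolding h_def by (rule le[OF Z_meas Z_nonneg Z_fin])
      then show ?thesis using h_int[of n] by (simp add: prob_space)
    qed
    show "(\<integral>\<omega>. h n \<omega> + c \<partial>M) \<le> C + c" by (rule *)
    have "0 \<le> (\<integral>\<omega>. h 0 \<omega> + c \<partial>M)" using h_lb by (intro integral_nonneg_AE) auto
    with *[of 0] show "0 \<le> C + c" by linarith
  qed
  \<comment> \<open>After the shift by c the \<open>h n\<close> are nonnegative and increasing;
    \<open>e2ennreal\<close> commutes with increasing suprema, which prepares monotone
    convergence.\<close>
  have "(\<integral>\<^sup>+ \<omega>. e2ennreal ((SUP n. ereal (h n \<omega>)) + ereal c) \<partial>M) =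
      (\<integral>\<^sup>+ \<omega>. (SUP n. ennreal (h n \<omega> + c)) \<partial>M)"
  proof (intro nn_integral_cong)
    fix \<omega>
    have "(SUP n. ereal (h n \<omega>)) + ereal c = (SUP n. ereal (h n \<omega> + c))"
      by (subst SUP_ereal_add_left[symmetric]) auto
    also have "e2ennreal \<dots> = (SUP n. e2ennreal (ereal (h n \<omega> + c)))"
      by (rule sup_continuousD[OF sup_continuous_e2ennreal[OF sup_continuous_id]])
         (auto simp: incseq_def intro: h_mono[THEN incseqD])
    finally show "e2ennreal ((SUP n. ereal (h n \<omega>)) + ereal c) = (SUP n. ennreal (h n \<omega> + c))"
      by (simp add: e2ennreal_ereal)
  qed
  also have "\<dots> = (SUP n. \<integral>\<^sup>+ \<omega>. ennreal (h n \<omega> + c) \<partial>M)"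
    using h_mono by (intro nn_integral_monotone_convergence_SUP)
      (auto simp: incseq_def le_fun_def intro!: ennreal_leI)
  also have "\<dots> \<le> ennreal (C + c)"
  proof (rule SUP_least)
    fix n
    have "(\<integral>\<^sup>+ \<omega>. ennreal (h n \<omega> + c) \<partial>M) = ennreal (\<integral>\<omega>. h n \<omega> + c \<partial>M)"
      using h_int h_lb by (intro nn_integral_eq_integral) auto
    then show "(\<integral>\<^sup>+ \<omega>. ennreal (h n \<omega> + c) \<partial>M) \<le> ennreal (C + c)"
      using C by (simp add: ennreal_leI)
  qed
  finally have "enn2ereal (\<integral>\<^sup>+ \<omega>. e2ennreal ((SUP n. ereal (h n \<omega>)) + ereal c) \<partial>M) \<le> ereal (C + c)"
    using C(1) by (metis enn2ereal_ennreal less_eq_ennreal.rep_eq)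
  then have "enn2ereal (\<integral>\<^sup>+ \<omega>. e2ennreal ((SUP n. ereal (h n \<omega>)) + ereal c) \<partial>M) - ereal c \<le> ereal C"
    by (cases "\<integral>\<^sup>+ \<omega>. e2ennreal ((SUP n. ereal (h n \<omega>)) + ereal c) \<partial>M")
       (auto simp: enn2ereal_ennreal)
  moreover have "expect M (\<lambda>\<omega>. SUP n. ereal (h n \<omega>)) =
      enn2ereal (\<integral>\<^sup>+ \<omega>. e2ennreal ((SUP n. ereal (h n \<omega>)) + ereal c) \<partial>M) - ereal c"
  proof (rule expect_eq_shift)
    show "prob_space M" by (rule prob_space_axioms)
    show "0 \<le> c" by (simp add: c_def)
    show "- ereal c \<le> (SUP n. ereal (h n \<omega>))" for \<omega> by (rule lb)
  qed simp
  ultimately show ?thesis by (simp add: SUP_h)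
qed


section \<open>Densities, Young's inequality and iterated suprema\<close>

lemma emeasure_density_space:
  "f \<in> borel_measurable M \<Longrightarrow> emeasure (density M f) (space M) = (\<integral>\<^sup>+ x. f x \<partial>M)"
  by (subst emeasure_density) (auto intro!: nn_integral_cong)

text \<open>V W is at most K plus the positive part of V W - K, which is what \<open>ennreal\<close>
  computes; both have finite integral. In the application K is F(Z) and G the truncated conjugate,
  so that Orlicz membership yields integrability of Z X.\<close>

lemma integrable_mult_young:
  fixes V W K :: "'a \<Rightarrow> real" and G :: "'a \<Rightarrow> ennreal"
  assumes [measurable]: "V \<in> borel_measurable M" "W \<in> borel_measurable M"
    and nonneg: "\<And>\<omega>. 0 \<le> V \<omega>" "\<And>\<omega>. 0 \<le> W \<omega>" "\<And>\<omega>. 0 \<le> K \<omega>"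
    and K: "integrable M K" and G: "(\<integral>\<^sup>+ \<omega>. G \<omega> \<partial>M) < \<infinity>"
    and young: "\<And>\<omega>. ennreal (V \<omega> * W \<omega> - K \<omega>) \<le> G \<omega>"
  shows "integrable M (\<lambda>\<omega>. V \<omega> * W \<omega>)"
proof (rule integrableI_bounded)
  have [measurable]: "K \<in> borel_measurable M" using K by auto
  have split: "ennreal a \<le> ennreal b + ennreal (a - b)" if "0 \<le> b" for a b
    using that by (cases "a \<le> b") (auto simp: ennreal_leI add_increasing2 simp flip: ennreal_plus)
  have "(\<integral>\<^sup>+ \<omega>. ennreal (norm (V \<omega> * W \<omega>)) \<partial>M) \<le>
      (\<integral>\<^sup>+ \<omega>. ennreal (K \<omega>) + ennreal (V \<omega> * W \<omega> - K \<omega>) \<partial>M)"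
    using nonneg split by (intro nn_integral_mono) simp
  also have "\<dots> = (\<integral>\<^sup>+ \<omega>. ennreal (K \<omega>) \<partial>M) + (\<integral>\<^sup>+ \<omega>. ennreal (V \<omega> * W \<omega> - K \<omega>) \<partial>M)"
    by (rule nn_integral_add) simp_all
  also have "\<dots> \<le> (\<integral>\<^sup>+ \<omega>. ennreal (K \<omega>) \<partial>M) + (\<integral>\<^sup>+ \<omega>. G \<omega> \<partial>M)"
    by (intro add_left_mono nn_integral_mono young)
  also have "\<dots> < \<infinity>"
    using G nonneg K by (simp add: nn_integral_eq_integral)
  finally show "(\<integral>\<^sup>+ \<omega>. ennreal (norm (V \<omega> * W \<omega>)) \<partial>M) < \<infinity>" .
qed simp

lemma SUP_Times:
  fixes h :: "'b \<Rightarrow> 'c \<Rightarrow> 'd::complete_lattice"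
  shows "(SUP (x, y)\<in>A \<times> B. h x y) = (SUP x\<in>A. SUP y\<in>B. h x y)"
proof (rule antisym)
  show "(SUP (x, y)\<in>A \<times> B. h x y) \<le> (SUP x\<in>A. SUP y\<in>B. h x y)"
    by (rule SUP_least) (auto intro: SUP_upper2)
  show "(SUP x\<in>A. SUP y\<in>B. h x y) \<le> (SUP (x, y)\<in>A \<times> B. h x y)"
  proof (intro SUP_least)
    fix x y assume "x \<in> A" "y \<in> B"
    then show "h x y \<le> (SUP (x, y)\<in>A \<times> B. h x y)"
      using SUP_upper[of "(x, y)" "A \<times> B" "\<lambda>(x, y). h x y"] by simp
  qed
qed

section \<open>Duality over densities\<close>

text \<open>F is the divergence as a real function. Of the Orlicz condition only integrability of X
  remains here; integrability of Z X is built into \<open>dens\<close> and is verified for feasible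
  measures where the locale is applied.\<close>

locale divergence_problem = prob_space P for P :: "'a measure" +
  fixes F :: "real \<Rightarrow> real" and \<epsilon> :: real and X :: "'a \<Rightarrow> real"
  assumes F_nonneg: "0 \<le> x \<Longrightarrow> 0 \<le> F x"
    and F_1: "F 1 = 0"
    and F_convex: "convex_on {0..} F"
    and F_cont: "continuous_on {0<..} F"
    and F_meas[measurable]: "F \<in> borel_measurable borel"
    and eps_pos: "0 < \<epsilon>"
    and X_int: "integrable P X"
begin

definition conjugate :: "real \<Rightarrow> ereal" where
  "conjugate y = (SUP x\<in>{0..}. ereal (x * y - F x / \<epsilon>))"

text \<open>The domain of the convex program: total mass 1 is left out because it is the equality
  constraint, and the integrability conditions keep objective and constraints real-valued.\<close>

definition dens :: "('a \<Rightarrow> real) set" where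
  "dens = {Z. (\<forall>\<omega>. 0 \<le> Z \<omega>) \<and> integrable P Z \<and> integrable P (\<lambda>\<omega>. Z \<omega> * X \<omega>) \<and>
     integrable P (\<lambda>\<omega>. F (Z \<omega>))}"

lemma X_meas[measurable]: "X \<in> borel_measurable P"
  using X_int by auto

lemma dens_const: "0 \<le> x \<Longrightarrow> (\<lambda>_. x) \<in> dens"
  using X_int by (auto simp: dens_def)

lemma dens_convex_comb:
  assumes "V \<in> dens" "W \<in> dens" and uv: "0 \<le> u" "0 \<le> v" "u + v = 1"
  shows "(\<lambda>\<omega>. u * V \<omega> + v * W \<omega>) \<in> dens"
    and "(\<integral>\<omega>. F (u * V \<omega> + v * W \<omega>) \<partial>P) \<le> u * (\<integral>\<omega>. F (V \<omega>) \<partial>P) + v * (\<integral>\<omega>. F (W \<omega>) \<partial>P)"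
proof -
  have V: "\<And>\<omega>. 0 \<le> V \<omega>" "integrable P V" "integrable P (\<lambda>\<omega>. V \<omega> * X \<omega>)"
      "integrable P (\<lambda>\<omega>. F (V \<omega>))"
    and W: "\<And>\<omega>. 0 \<le> W \<omega>" "integrable P W" "integrable P (\<lambda>\<omega>. W \<omega> * X \<omega>)"
      "integrable P (\<lambda>\<omega>. F (W \<omega>))"
    using assms by (auto simp: dens_def)
  have [measurable]: "V \<in> borel_measurable P" "W \<in> borel_measurable P" using V W by auto
  have nonneg: "0 \<le> u * V \<omega> + v * W \<omega>" for \<omega> using V W uv by simp
  have conv: "F (u * V \<omega> + v * W \<omega>) \<le> u * F (V \<omega>) + v * F (W \<omega>)" for \<omega>
    using F_convex V(1) W(1) uv unfolding convex_on_def by auto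
  have sum_int: "integrable P (\<lambda>\<omega>. u * F (V \<omega>) + v * F (W \<omega>))" using V W by auto
  \<comment> \<open>The integrand lies between 0 and the integrable convex combination
    \<open>sum_int\<close>.\<close>
  have F_int: "integrable P (\<lambda>\<omega>. F (u * V \<omega> + v * W \<omega>))"
    using conv F_nonneg[OF nonneg]
    by (intro Bochner_Integration.integrable_bound[OF sum_int] AE_I2)
       (auto intro!: order_trans[OF conv])
  have "integrable P (\<lambda>\<omega>. u * (V \<omega> * X \<omega>) + v * (W \<omega> * X \<omega>))" using V W by auto
  then have "integrable P (\<lambda>\<omega>. (u * V \<omega> + v * W \<omega>) * X \<omega>)" by (simp add: algebra_simps)
  then show "(\<lambda>\<omega>. u * V \<omega> + v * W \<omega>) \<in> dens"
    using nonneg F_int V W by (simp add: dens_def)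
  have "(\<integral>\<omega>. F (u * V \<omega> + v * W \<omega>) \<partial>P) \<le> (\<integral>\<omega>. u * F (V \<omega>) + v * F (W \<omega>) \<partial>P)"
    by (intro integral_mono F_int sum_int conv)
  then show "(\<integral>\<omega>. F (u * V \<omega> + v * W \<omega>) \<partial>P) \<le> u * (\<integral>\<omega>. F (V \<omega>) \<partial>P) + v * (\<integral>\<omega>. F (W \<omega>) \<partial>P)"
    using V W by simp
qed

lemma dens_finite_range:
  assumes Z: "Z \<in> borel_measurable P" "\<And>\<omega>. 0 \<le> Z \<omega>" "finite (range Z)"
  shows "Z \<in> dens"
proof -
  note [measurable] = Z(1)
  have "finite (Z ` space P)" "finite ((\<lambda>\<omega>. F (Z \<omega>)) ` space P)"
    using Z(3) by (auto intro: finite_subset[of _ "range Z"] finite_subset[of _ "F ` range Z"])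
  moreover from this have "integrable P (\<lambda>\<omega>. Z \<omega> * X \<omega>)"
    using X_int by (intro integrable_mult_finite_range) auto
  ultimately show ?thesis
    using Z(2) by (auto simp: dens_def intro!: integrable_finite_range)
qed

lemma weak_duality:
  assumes Z: "Z \<in> dens" "(\<integral>\<omega>. F (Z \<omega>) \<partial>P) \<le> \<epsilon>" "(\<integral>\<omega>. Z \<omega> \<partial>P) = 1" and t: "0 < t"
  shows "ereal \<mu> - ereal t * (1 + expect P (\<lambda>\<omega>. conjugate (- ((X \<omega> - \<mu>) / t))))
    \<le> ereal (\<integral>\<omega>. Z \<omega> * X \<omega> \<partial>P)"
proof -
  have Z': "\<And>\<omega>. 0 \<le> Z \<omega>" "integrable P Z" "integrable P (\<lambda>\<omega>. Z \<omega> * X \<omega>)"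
      "integrable P (\<lambda>\<omega>. F (Z \<omega>))"
    using Z by (auto simp: dens_def)
  \<comment> \<open>This is x y - F x/\<epsilon> at x = Z and y = -(X - \<mu>)/t. It is integrable,
    so its expectation is an ordinary integral even where that of the conjugate is infinite.\<close>
  define h where "h \<omega> = (\<mu> * Z \<omega> - Z \<omega> * X \<omega>) / t - F (Z \<omega>) / \<epsilon>" for \<omega>
  have h_int: "integrable P h" unfolding h_def using Z' by auto
  have "ereal (h \<omega>) \<le> conjugate (- ((X \<omega> - \<mu>) / t))" for \<omega>
  proof -
    have "h \<omega> = Z \<omega> * (- ((X \<omega> - \<mu>) / t)) - F (Z \<omega>) / \<epsilon>"
      using t by (simp add: h_def field_simps)
    then show ?thesis unfolding conjugate_def using Z'(1) by (intro SUP_upper2[of "Z \<omega>"]) auto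
  qed
  then have "expect P (\<lambda>\<omega>. ereal (h \<omega>)) \<le> expect P (\<lambda>\<omega>. conjugate (- ((X \<omega> - \<mu>) / t)))"
    by (intro expect_mono)
  moreover have "(\<integral>\<omega>. h \<omega> \<partial>P) =
      (\<mu> - (\<integral>\<omega>. Z \<omega> * X \<omega> \<partial>P)) / t - (\<integral>\<omega>. F (Z \<omega>) \<partial>P) / \<epsilon>"
    unfolding h_def using Z' Z(3) by simp
  ultimately have le: "ereal ((\<mu> - (\<integral>\<omega>. Z \<omega> * X \<omega> \<partial>P)) / t - (\<integral>\<omega>. F (Z \<omega>) \<partial>P) / \<epsilon>)
      \<le> expect P (\<lambda>\<omega>. conjugate (- ((X \<omega> - \<mu>) / t)))"
    using expect_eq_integral[OF h_int] by simp
  have "(\<integral>\<omega>. F (Z \<omega>) \<partial>P) / \<epsilon> \<le> 1" using Z(2) eps_pos by simp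
  show ?thesis
  proof (cases "expect P (\<lambda>\<omega>. conjugate (- ((X \<omega> - \<mu>) / t)))")
    case (real r)
    then have "(\<mu> - (\<integral>\<omega>. Z \<omega> * X \<omega> \<partial>P)) / t \<le> 1 + r"
      using le \<open>_ / \<epsilon> \<le> 1\<close> by simp
    then have "\<mu> - (\<integral>\<omega>. Z \<omega> * X \<omega> \<partial>P) \<le> t * (1 + r)" using t by (simp add: field_simps)
    then show ?thesis by (simp add: real one_ereal_def)
  qed (use le t in \<open>auto simp: one_ereal_def\<close>)
qed

text \<open>The Lagrangian inequality, rearranged, bounds E[Z y - F(Z)/\<epsilon>] uniformly in Z;
  \<open>expect_SUP_le\<close> moves the supremum over Z inside the expectation.\<close>

lemma strong_duality:
  assumes p: "\<And>Z. Z \<in> dens \<Longrightarrow> (\<integral>\<omega>. F (Z \<omega>) \<partial>P) \<le> \<epsilon> \<Longrightarrow> (\<integral>\<omega>. Z \<omega> \<partial>P) = 1 \<Longrightarrow>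
      p \<le> (\<integral>\<omega>. Z \<omega> * X \<omega> \<partial>P)"
    and \<delta>: "0 < \<delta>"
  shows "\<exists>\<mu> t. 0 < t \<and>
    ereal (p - \<delta>) \<le> ereal \<mu> - ereal t * (1 + expect P (\<lambda>\<omega>. conjugate (- ((X \<omega> - \<mu>) / t))))"
proof -
  define a where "a Z = (\<integral>\<omega>. Z \<omega> * X \<omega> \<partial>P)" for Z :: "'a \<Rightarrow> real"
  \<comment> \<open>Dividing by \<epsilon> makes the multiplier of \<open>b\<close> the variable t
    of the dual problem, up to \<delta>.\<close>
  define b where "b Z = (\<integral>\<omega>. F (Z \<omega>) \<partial>P) / \<epsilon> - 1" for Z :: "'a \<Rightarrow> real"
  define c where "c Z = (\<integral>\<omega>. Z \<omega> \<partial>P) - 1" for Z :: "'a \<Rightarrow> real"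
  have "\<exists>\<tau>\<ge>0. \<exists>m. \<forall>Z\<in>dens. p \<le> a Z + \<tau> * b Z + m * c Z"
  proof (rule lagrange_multipliers)
    fix V W and u v :: real
    assume VW: "V \<in> dens" "W \<in> dens" and uv: "0 \<le> u" "0 \<le> v" "u + v = 1"
    have int: "integrable P V" "integrable P (\<lambda>\<omega>. V \<omega> * X \<omega>)"
        "integrable P W" "integrable P (\<lambda>\<omega>. W \<omega> * X \<omega>)"
      using VW by (auto simp: dens_def)
    let ?U = "\<lambda>\<omega>. u * V \<omega> + v * W \<omega>"
    have "a ?U = (\<integral>\<omega>. u * (V \<omega> * X \<omega>) + v * (W \<omega> * X \<omega>) \<partial>P)"
      unfolding a_def by (simp add: algebra_simps)
    then have "a ?U \<le> u * a V + v * a W" using int by (simp add: a_def)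
    moreover have "b ?U \<le> u * b V + v * b W"
    proof -
      have "b ?U \<le> (u * (\<integral>\<omega>. F (V \<omega>) \<partial>P) + v * (\<integral>\<omega>. F (W \<omega>) \<partial>P)) / \<epsilon> - (u + v)"
        using dens_convex_comb(2)[OF VW uv] eps_pos uv by (simp add: b_def divide_right_mono)
      then show ?thesis by (simp add: b_def algebra_simps add_divide_distrib)
    qed
    moreover have "c ?U = u * c V + v * c W"
    proof -
      have "c ?U = u * (\<integral>\<omega>. V \<omega> \<partial>P) + v * (\<integral>\<omega>. W \<omega> \<partial>P) - (u + v)"
        using int uv by (simp add: c_def)
      then show ?thesis by (simp add: c_def algebra_simps)
    qed
    ultimately show "\<exists>U\<in>dens. a U \<le> u * a V + v * a W \<and> b U \<le> u * b V + v * b W \<and>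
        c U = u * c V + v * c W"
      using dens_convex_comb(1)[OF VW uv] by blast
  next
    fix Z assume "Z \<in> dens" "b Z \<le> 0" "c Z = 0"
    then show "p \<le> a Z" using p eps_pos by (simp add: a_def b_def c_def)
  next
    show "(\<lambda>_. 1) \<in> dens" "(\<lambda>_. 0) \<in> dens" "(\<lambda>_. 2) \<in> dens" by (simp_all add: dens_const)
    show "b (\<lambda>_. 1) < 0" "c (\<lambda>_. 1) = 0" "c (\<lambda>_. 0) < 0" "0 < c (\<lambda>_. 2)"
      by (simp_all add: b_def c_def F_1 prob_space)
  qed
  then obtain \<tau> m where \<tau>: "0 \<le> \<tau>"
    and lagrange: "\<And>Z. Z \<in> dens \<Longrightarrow> p \<le> a Z + \<tau> * b Z + m * c Z" by blast
  \<comment> \<open>The multiplier \<open>\<tau>\<close> may be \<open>0\<close>; since \<open>b \<ge> -1\<close>, enlarging it by \<open>\<delta>\<close> costs at most \<open>\<delta>\<close>.\<close>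
  define t \<mu> where "t = \<tau> + \<delta>" and "\<mu> = - m"
  have t: "0 < t" using \<tau> \<delta> by (simp add: t_def)
  \<comment> \<open>C solves \<mu> - t (1 + C) = p - \<delta>, the dual value to be reached.\<close>
  define C where "C = (\<mu> - t + \<delta> - p) / t"
  have "expect P (\<lambda>\<omega>. conjugate (- ((X \<omega> - \<mu>) / t))) \<le> ereal C"
    unfolding conjugate_def
  proof (rule expect_SUP_le)
    show "prob_space P" by (rule prob_space_axioms)
    show "integrable P (\<lambda>\<omega>. - ((X \<omega> - \<mu>) / t))" using X_int by simp
    show "(\<lambda>x. F x / \<epsilon>) \<in> borel_measurable borel" by simp
    show "continuous_on {0<..} (\<lambda>x. F x / \<epsilon>)"
      using eps_pos by (intro continuous_intros F_cont) auto
    fix Z :: "'a \<Rightarrow> real" assume Z: "Z \<in> borel_measurable P" "\<And>\<omega>. 0 \<le> Z \<omega>" "finite (range Z)"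
    then have dens: "Z \<in> dens" by (rule dens_finite_range)
    then have int: "integrable P Z" "integrable P (\<lambda>\<omega>. Z \<omega> * X \<omega>)"
      "integrable P (\<lambda>\<omega>. F (Z \<omega>))" by (auto simp: dens_def)
    have "0 \<le> (\<integral>\<omega>. F (Z \<omega>) \<partial>P)" using F_nonneg Z by (intro integral_nonneg_AE) auto
    then have "-1 \<le> b Z" using eps_pos by (simp add: b_def)
    then have "- \<delta> \<le> \<delta> * b Z" using \<delta> mult_left_mono[of "-1" "b Z" \<delta>] by simp
    with lagrange[OF dens] have "p - \<delta> \<le> a Z + t * b Z - \<mu> * c Z"
      by (simp add: t_def \<mu>_def algebra_simps)
    then have le: "\<mu> * (\<integral>\<omega>. Z \<omega> \<partial>P) - a Z - t * ((\<integral>\<omega>. F (Z \<omega>) \<partial>P) / \<epsilon>) \<le> \<mu> - t + \<delta> - p"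
      by (simp add: b_def c_def algebra_simps)
    have "(\<integral>\<omega>. Z \<omega> * (- ((X \<omega> - \<mu>) / t)) - F (Z \<omega>) / \<epsilon> \<partial>P) =
        (\<integral>\<omega>. (\<mu> * Z \<omega> - Z \<omega> * X \<omega>) / t - F (Z \<omega>) / \<epsilon> \<partial>P)"
      using t by (intro Bochner_Integration.integral_cong) (auto simp: field_simps)
    also have "\<dots> = (\<mu> * (\<integral>\<omega>. Z \<omega> \<partial>P) - a Z) / t - (\<integral>\<omega>. F (Z \<omega>) \<partial>P) / \<epsilon>"
      using int by (simp add: a_def)
    also have "\<dots> = (\<mu> * (\<integral>\<omega>. Z \<omega> \<partial>P) - a Z - t * ((\<integral>\<omega>. F (Z \<omega>) \<partial>P) / \<epsilon>)) / t"
      using t by (simp add: diff_divide_distrib)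
    also have "\<dots> \<le> C" unfolding C_def using t le by (intro divide_right_mono) auto
    finally show "(\<integral>\<omega>. Z \<omega> * (- ((X \<omega> - \<mu>) / t)) - F (Z \<omega>) / \<epsilon> \<partial>P) \<le> C" .
  qed
  then have "ereal (p - \<delta>) \<le> ereal \<mu> - ereal t * (1 + expect P (\<lambda>\<omega>. conjugate (- ((X \<omega> - \<mu>) / t))))"
  proof (cases "expect P (\<lambda>\<omega>. conjugate (- ((X \<omega> - \<mu>) / t)))")
    case (real r)
    assume "expect P (\<lambda>\<omega>. conjugate (- ((X \<omega> - \<mu>) / t))) \<le> ereal C"
    then have "t * (1 + r) \<le> t * (1 + C)" using real t by simp
    also have "\<dots> = \<mu> + \<delta> - p" using t by (simp add: C_def field_simps)
    finally show ?thesis by (simp add: real one_ereal_def)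
  qed (use t in \<open>auto simp: one_ereal_def\<close>)
  with t show ?thesis by blast
qed

section \<open>Densities and absolutely continuous probability measures\<close>

lemma expect_density:
  assumes Z: "Z \<in> dens"
  shows "expect (density P (\<lambda>\<omega>. ennreal (Z \<omega>))) (\<lambda>\<omega>. ereal (X \<omega>)) = ereal (\<integral>\<omega>. Z \<omega> * X \<omega> \<partial>P)"
proof -
  have [measurable]: "Z \<in> borel_measurable P" using Z by (auto simp: dens_def)
  have "integrable (density P (\<lambda>\<omega>. ennreal (Z \<omega>))) X"
    using Z by (subst integrable_density) (auto simp: dens_def)
  then show ?thesis
    using Z by (subst expect_eq_integral) (auto simp: integral_density dens_def)
qed

lemma density_in_ac_prob_measures:
  assumes Z: "Z \<in> dens" "(\<integral>\<omega>. Z \<omega> \<partial>P) = 1"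
  shows "density P (\<lambda>\<omega>. ennreal (Z \<omega>)) \<in> ac_prob_measures P"
    and "AE \<omega> in P. enn2real (RN_deriv P (density P (\<lambda>\<omega>. ennreal (Z \<omega>))) \<omega>) = Z \<omega>"
proof -
  have [measurable]: "Z \<in> borel_measurable P" using Z by (auto simp: dens_def)
  have "(\<integral>\<^sup>+ \<omega>. ennreal (Z \<omega>) \<partial>P) = ennreal (\<integral>\<omega>. Z \<omega> \<partial>P)"
    using Z by (intro nn_integral_eq_integral) (auto simp: dens_def)
  then have "prob_space (density P (\<lambda>\<omega>. ennreal (Z \<omega>)))"
    using Z(2) by (intro prob_spaceI) (simp add: emeasure_density_space)
  moreover have "absolutely_continuous P (density P (\<lambda>\<omega>. ennreal (Z \<omega>)))"
    by (intro absolutely_continuousI_density) simp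
  ultimately show "density P (\<lambda>\<omega>. ennreal (Z \<omega>)) \<in> ac_prob_measures P"
    by (simp add: ac_prob_measures_def)
  have "AE \<omega> in P. ennreal (Z \<omega>) = RN_deriv P (density P (\<lambda>\<omega>. ennreal (Z \<omega>))) \<omega>"
    by (intro RN_deriv_unique) auto
  then show "AE \<omega> in P. enn2real (RN_deriv P (density P (\<lambda>\<omega>. ennreal (Z \<omega>))) \<omega>) = Z \<omega>"
  proof eventually_elim
    case (elim \<omega>)
    have "0 \<le> Z \<omega>" using Z by (simp add: dens_def)
    then show ?case unfolding elim[symmetric] by simp
  qed
qed

text \<open>\<open>enn2real\<close> alters the Radon-Nikodym derivative only where it is infinite, a
  null set because Q is finite.\<close>

lemma ac_prob_measure_eq_density:
  assumes Q: "Q \<in> ac_prob_measures P"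
  shows "density P (\<lambda>\<omega>. ennreal (enn2real (RN_deriv P Q \<omega>))) = Q"
    and "integrable P (\<lambda>\<omega>. enn2real (RN_deriv P Q \<omega>))"
    and "(\<integral>\<omega>. enn2real (RN_deriv P Q \<omega>) \<partial>P) = 1"
proof -
  interpret Q: prob_space Q using Q by (simp add: ac_prob_measures_def)
  have ac: "absolutely_continuous P Q" "sets Q = sets P"
    using Q by (auto simp: ac_prob_measures_def)
  have fin: "AE \<omega> in P. ennreal (enn2real (RN_deriv P Q \<omega>)) = RN_deriv P Q \<omega>"
    using RN_deriv_finite[OF Q.sigma_finite_measure_axioms ac]
    by eventually_elim (auto simp: top.not_eq_extremum)
  then have "density P (\<lambda>\<omega>. ennreal (enn2real (RN_deriv P Q \<omega>))) = density P (RN_deriv P Q)"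
    by (intro density_cong) auto
  also have "\<dots> = Q" by (rule density_RN_deriv[OF ac])
  finally show eq: "density P (\<lambda>\<omega>. ennreal (enn2real (RN_deriv P Q \<omega>))) = Q" .
  have "(\<integral>\<^sup>+ \<omega>. ennreal (enn2real (RN_deriv P Q \<omega>)) \<partial>P) = 
      emeasure (density P (\<lambda>\<omega>. ennreal (enn2real (RN_deriv P Q \<omega>)))) (space P)"
    by (simp add: emeasure_density_space)
  also have "\<dots> = ennreal 1"
    unfolding eq using Q.emeasure_space_1 sets_eq_imp_space_eq[OF ac(2)] by simp
  finally have nn: "(\<integral>\<^sup>+ \<omega>. ennreal (enn2real (RN_deriv P Q \<omega>)) \<partial>P) = ennreal 1" .
  show "integrable P (\<lambda>\<omega>. enn2real (RN_deriv P Q \<omega>))"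
    using nn by (intro integrableI_bounded) auto
  show "(\<integral>\<omega>. enn2real (RN_deriv P Q \<omega>) \<partial>P) = 1"
    using nn by (subst integral_eq_nn_integral) auto
qed

end


section \<open>From extended-valued divergences to the real-valued problem\<close>

lemma convex_conjugate_eq_SUP:
  assumes "\<And>x. x < 0 \<Longrightarrow> f x = \<infinity>" and "\<And>x. 0 \<le> x \<Longrightarrow> f x = ereal (F x)"
  shows "convex_conjugate f y = (SUP x\<in>{0..}. ereal (x * y - F x))"
  unfolding convex_conjugate_def
proof (rule antisym)
  show "(SUP x. ereal (x * y) - f x) \<le> (SUP x\<in>{0..}. ereal (x * y - F x))"
  proof (rule SUP_least)
    fix x :: real
    show "ereal (x * y) - f x \<le> (SUP x\<in>{0..}. ereal (x * y - F x))"
      using assms by (cases "x < 0") (auto intro: SUP_upper2[of x])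
  qed
  show "(SUP x\<in>{0..}. ereal (x * y - F x)) \<le> (SUP x. ereal (x * y) - f x)"
  proof (rule SUP_least)
    fix x :: real assume "x \<in> {0..}"
    then show "ereal (x * y - F x) \<le> (SUP x. ereal (x * y) - f x)"
      using assms(2)[of x] by (intro SUP_upper2[of x]) auto
  qed
qed

lemma divergence_real:
  assumes "is_divergence f"
    and F_def: "F = (\<lambda>x. real_of_ereal (f x))"
  shows "0 \<le> x \<Longrightarrow> f x = ereal (F x)"
    and "0 \<le> x \<Longrightarrow> 0 \<le> F x"
    and "F 1 = 0"
    and "convex_on {0..} F"
    and "continuous_on {0<..} F"
    and "F \<in> borel_measurable borel"
proof -
  note div = assms(1)[unfolded is_divergence_def]
  show f_eq: "f x = ereal (F x)" if "0 \<le> x" for x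
  proof -
    have "0 \<le> f x" "f x < \<infinity>" using div that by auto
    then show ?thesis by (cases "f x") (auto simp: F_def)
  qed
  show "0 \<le> F x" if "0 \<le> x" for x using div that by (simp add: F_def real_of_ereal_pos)
  show "F 1 = 0" using div by (simp add: F_def)
  show "convex_on {0..} F"
    unfolding convex_on_def
  proof (intro conjI ballI allI impI)
    fix x y u v :: real
    assume *: "x \<in> {0..}" "y \<in> {0..}" "0 \<le> u" "0 \<le> v" "u + v = 1"
    then have "f (u * x + v * y) \<le> ereal u * f x + ereal v * f y"
      using div unfolding ereal_convex_on_def by blast
    then show "F (u *\<^sub>R x + v *\<^sub>R y) \<le> u * F x + v * F y"
      using * by (simp add: f_eq)
  qed (rule convex_real_interval)
  from div obtain F' where F': "\<And>x. 0 < x \<Longrightarrow> (F has_real_derivative F' x) (at x)"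
    unfolding C2_on_pos_def F_def by blast
  show cont: "continuous_on {0<..} F"
    by (rule DERIV_continuous_on) (use F' in \<open>auto intro: has_field_derivative_at_within\<close>)
  \<comment> \<open>\<open>real_of_ereal\<close> sends \<infinity> to 0, so F vanishes on the
    negative numbers. The point 0 is split off because continuity is known only to its
    right.\<close>
  have "F = (\<lambda>x. indicator {0<..} x *\<^sub>R F x + indicator {0} x * F 0)"
  proof
    fix x :: real
    have "F x = 0" if "x < 0" using div that by (simp add: F_def)
    then show "F x = indicator {0<..} x *\<^sub>R F x + indicator {0} x * F 0"
      by (cases x "0 :: real" rule: linorder_cases) auto
  qed
  also have "\<dots> \<in> borel_measurable borel"
    by (intro borel_measurable_add borel_measurable_continuous_on_indicator cont) auto
  finally show "F \<in> borel_measurable borel" .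
qed

theorem proposition2:
  fixes P :: "'a measure" and f g :: "real \<Rightarrow> ereal" and \<epsilon> :: real and X :: "'a \<Rightarrow> real"
  assumes "prob_space P" and "complete_measure P"
    and "is_divergence f" and "g = convex_conjugate f"
    and "\<epsilon> > 0"
    and "X \<in> Orlicz_space P (bar g)"
  shows "lower_risk P f \<epsilon> X =
           (SUP \<mu>::real. ereal \<mu> + lower_regret P (scaled_conjugate g \<epsilon>) (\<lambda>\<omega>. X \<omega> - \<mu>))
       \<and> (SUP \<mu>::real. ereal \<mu> + lower_regret P (scaled_conjugate g \<epsilon>) (\<lambda>\<omega>. X \<omega> - \<mu>)) =
           (SUP (\<mu>, t)\<in>(UNIV :: real set) \<times> {0<..}.
              ereal \<mu> - ereal t * (1 + expect P (\<lambda>\<omega>. scaled_conjugate g \<epsilon> (- ((X \<omega> - \<mu>) / t)))))"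
proof -
  interpret prob_space P by fact
  define F where "F = (\<lambda>x. real_of_ereal (f x))"
  note F = divergence_real[OF assms(3) F_def]
  have f_neg: "f x = \<infinity>" if "x < 0" for x
    using assms(3) that by (simp add: is_divergence_def)
  have g_eq: "g y = (SUP x\<in>{0..}. ereal (x * y - F x))" for y
    unfolding assms(4) by (rule convex_conjugate_eq_SUP[OF f_neg F(1)])
  from assms(6) obtain l where X_meas[measurable]: "X \<in> borel_measurable P" and l: "0 < l"
    and "expect P (\<lambda>\<omega>. bar g (\<bar>X \<omega>\<bar> / l)) < \<infinity>"
    by (auto simp: Orlicz_space_def)
  moreover have "bar g (\<bar>X \<omega>\<bar> / l) = g (\<bar>X \<omega>\<bar> / l)" for \<omega>
    using l by (simp add: bar_def divide_less_0_iff)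
  ultimately have "expect P (\<lambda>\<omega>. g (\<bar>X \<omega>\<bar> / l)) < \<infinity>" by simp
  then have G: "(\<integral>\<^sup>+ \<omega>. e2ennreal (g (\<bar>X \<omega>\<bar> / l)) \<partial>P) < \<infinity>"
    by (rule expect_less_top)
  \<comment> \<open>The Orlicz hypothesis enters here, through Z \<bar>X\<bar>/l \<le> F(Z) +
    g(\<bar>X\<bar>/l).\<close>
  have ZX_int: "integrable P (\<lambda>\<omega>. Z \<omega> * X \<omega>)"
    if [measurable]: "Z \<in> borel_measurable P" and Z: "\<And>\<omega>. 0 \<le> Z \<omega>"
      and FZ: "integrable P (\<lambda>\<omega>. F (Z \<omega>))" for Z
  proof -
    have "integrable P (\<lambda>\<omega>. Z \<omega> * (\<bar>X \<omega>\<bar> / l))"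
    proof (rule integrable_mult_young[OF _ _ _ _ _ FZ G])
      fix \<omega>
      have "ereal (Z \<omega> * (\<bar>X \<omega>\<bar> / l) - F (Z \<omega>)) \<le> g (\<bar>X \<omega>\<bar> / l)"
        unfolding g_eq using Z by (intro SUP_upper) simp
      then show "ennreal (Z \<omega> * (\<bar>X \<omega>\<bar> / l) - F (Z \<omega>)) \<le> e2ennreal (g (\<bar>X \<omega>\<bar> / l))"
        by (metis e2ennreal_ereal e2ennreal_mono)
    qed (use Z F(2) l in auto)
    then have "integrable P (\<lambda>\<omega>. l * (Z \<omega> * (\<bar>X \<omega>\<bar> / l)))"
      by (rule integrable_mult_right)
    then have "integrable P (\<lambda>\<omega>. \<bar>Z \<omega> * X \<omega>\<bar>)" using l Z by (simp add: abs_mult)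
    then show ?thesis by (subst (asm) integrable_abs_iff) auto
  qed
  \<comment> \<open>The constant density 1 gives integrability of X itself.\<close>
  have "integrable P (\<lambda>\<omega>. 1 * X \<omega>)" by (rule ZX_int) auto
  then interpret divergence_problem P F \<epsilon> X
    using assms(5) F by unfold_locales auto
  have conjugate: "scaled_conjugate g \<epsilon> = conjugate"
  proof
    fix y
    have "scaled_conjugate g \<epsilon> y = convex_conjugate (\<lambda>x. ereal (inverse \<epsilon>) * f x) y"
      unfolding assms(4) scaled_conjugate_eq[OF assms(5)] ..
    also have "\<dots> = (SUP x\<in>{0..}. ereal (x * y - F x / \<epsilon>))"
      by (rule convex_conjugate_eq_SUP)
         (use assms(5) in \<open>simp_all add: f_neg F(1) divide_inverse mult.commute\<close>)
    finally show "scaled_conjugate g \<epsilon> y = conjugate y" by (simp add: conjugate_def)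
  qed
  define d where "d = (SUP (\<mu>, t)\<in>(UNIV :: real set) \<times> {0<..}.
      ereal \<mu> - ereal t * (1 + expect P (\<lambda>\<omega>. conjugate (- ((X \<omega> - \<mu>) / t)))))"
  have regret: "(SUP \<mu>. ereal \<mu> + lower_regret P conjugate (\<lambda>\<omega>. X \<omega> - \<mu>)) = d"
    unfolding d_def SUP_Times lower_regret_def
    by (subst SUP_ereal_add_right[symmetric]) (auto simp: minus_ereal_def minus_divide_left)
  have d_le: "d \<le> lower_risk P f \<epsilon> X"
    unfolding lower_risk_def
  proof (rule Inf_greatest, clarify)
    fix Q assume Q: "Q \<in> ac_prob_measures P"
      and le: "expect P (\<lambda>\<omega>. f (enn2real (RN_deriv P Q \<omega>))) \<le> ereal \<epsilon>"
    define Z where "Z = (\<lambda>\<omega>. enn2real (RN_deriv P Q \<omega>))"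
    have [measurable]: "Z \<in> borel_measurable P" unfolding Z_def by simp
    have Z_nonneg: "0 \<le> Z \<omega>" for \<omega> by (simp add: Z_def)
    have le: "expect P (\<lambda>\<omega>. ereal (F (Z \<omega>))) \<le> ereal \<epsilon>"
      using le F(1)[OF Z_nonneg] by (simp add: Z_def)
    then have "expect P (\<lambda>\<omega>. ereal (F (Z \<omega>))) < \<infinity>" by (rule order.strict_trans1) simp
    then have "(\<integral>\<^sup>+ \<omega>. ennreal (F (Z \<omega>)) \<partial>P) < \<infinity>"
      by (drule_tac expect_less_top) (simp add: e2ennreal_ereal)
    then have FZ: "integrable P (\<lambda>\<omega>. F (Z \<omega>))"
      using F(2)[OF Z_nonneg] by (intro integrableI_bounded) auto
    have "Z \<in> dens"
      using ZX_int[OF _ Z_nonneg FZ] ac_prob_measure_eq_density(2)[OF Q] Z_nonneg FZ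
      by (simp add: dens_def Z_def)
    moreover have "(\<integral>\<omega>. F (Z \<omega>) \<partial>P) \<le> \<epsilon>"
      using le by (simp add: expect_eq_integral[OF FZ])
    moreover have "(\<integral>\<omega>. Z \<omega> \<partial>P) = 1"
      unfolding Z_def by (rule ac_prob_measure_eq_density(3)[OF Q])
    moreover have "expect Q (\<lambda>\<omega>. ereal (X \<omega>)) = ereal (\<integral>\<omega>. Z \<omega> * X \<omega> \<partial>P)"
      using expect_density[OF \<open>Z \<in> dens\<close>] ac_prob_measure_eq_density(1)[OF Q]
      by (simp add: Z_def)
    ultimately show "d \<le> expect Q (\<lambda>\<omega>. ereal (X \<omega>))"
      unfolding d_def by (auto intro!: SUP_least weak_duality)
  qed
  have risk_le: "lower_risk P f \<epsilon> X \<le> ereal (\<integral>\<omega>. Z \<omega> * X \<omega> \<partial>P)"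
    if Z: "Z \<in> dens" "(\<integral>\<omega>. F (Z \<omega>) \<partial>P) \<le> \<epsilon>" "(\<integral>\<omega>. Z \<omega> \<partial>P) = 1" for Z
  proof -
    let ?Q = "density P (\<lambda>\<omega>. ennreal (Z \<omega>))"
    have "AE \<omega> in P. f (enn2real (RN_deriv P ?Q \<omega>)) = ereal (F (Z \<omega>))"
      using density_in_ac_prob_measures(2)[OF Z(1,3)]
    proof eventually_elim
      case (elim \<omega>)
      then show ?case using Z(1) by (simp add: F(1) dens_def)
    qed
    then have "expect P (\<lambda>\<omega>. f (enn2real (RN_deriv P ?Q \<omega>))) = ereal (\<integral>\<omega>. F (Z \<omega>) \<partial>P)"
      using Z(1) by (subst expect_cong_AE) (auto simp: expect_eq_integral dens_def)
    then show ?thesis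
      unfolding lower_risk_def expect_density[OF Z(1), symmetric]
      using density_in_ac_prob_measures(1)[OF Z(1,3)] Z(2) by (intro Inf_lower) auto
  qed
  have "lower_risk P f \<epsilon> X \<le> d"
  proof (cases "lower_risk P f \<epsilon> X")
    case (real p)
    show ?thesis
      unfolding real
    proof (rule ereal_le_epsilon2)
      fix \<delta> :: real assume "0 < \<delta>"
      then obtain \<mu> t where t: "0 < t" and
        le: "ereal (p - \<delta>) \<le> ereal \<mu> - ereal t * (1 + expect P (\<lambda>\<omega>. conjugate (- ((X \<omega> - \<mu>) / t))))"
        using strong_duality[of p \<delta>] risk_le real by auto
      note le
      also have "ereal \<mu> - ereal t * (1 + expect P (\<lambda>\<omega>. conjugate (- ((X \<omega> - \<mu>) / t)))) \<le> d"
        unfolding d_def using t by (intro SUP_upper2[of "(\<mu>, t)"]) auto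
      finally show "ereal p \<le> d + ereal \<delta>"
        by (cases d) auto
    qed
  next
    \<comment> \<open>Impossible: the density 1 has divergence 0 and a finite objective
      value.\<close>
    case PInf
    with risk_le[OF dens_const[of 1]] assms(5) show ?thesis by (simp add: prob_space F(3))
  qed simp
  with d_le have "lower_risk P f \<epsilon> X = d" by (rule antisym[rotated])
  then show ?thesis
    unfolding conjugate regret by (simp add: d_def)
qed

end
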